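(* Let $L$ be a first-order language, $D$ a new $r$-ary predicate symbol, and let $\phi(a_1,\ldots,a_r)$ be the formula $$(\exists x_1\cdots x_n)(a_1=t_1\wedge\cdots\wedge a_r=t_r\wedge A_1\wedge\cdots\wedge A_m),$$ where $t_1,\ldots,t_r$ are $L$-terms and $A_1,\ldots,A_m$ are $L$-atoms whose variables are all among $x_1,\ldots,x_n$. Then for any formula $\psi$ of the language $L\cup\{D\}$, $$\mathrm{LK}_\mathrm{e}^\mathrm{fcs}(D)\vdash\psi\quad\text{if and only if}\quad \mathrm{LK}_\mathrm{e}\vdash\psi[D\backslash\phi].$$
   Context: $\mathrm{LK}_\mathrm{e}$ is the standard sequent calculus (including cut) for first-order predicate logic with equality over the language $L$. A calculus proves a formula $\psi$ ($\vdash\psi$) if it derives the sequent $\rightarrow\psi$. $\psi[D\backslash\phi]$ is the formula obtained from $\psi$ by replacing $D$ by $\phi$, i.e. replacing every atomic subformula $D(s_1,\ldots,s_r)$ by $\phi(s_1,\ldots,s_r)$ (renaming bound variables as needed to avoid capture). $\mathrm{LK}_\mathrm{e}^\mathrm{fcs}(D)$ is the calculus obtained from $\mathrm{LK}_\mathrm{e}$, now used over the enlarged language $L\cup\{D\}$, by adding the following two rules, where $a_1,\ldots,a_r$ are arbitrary terms, $\underline{x}=(x_1,\ldots,x_n)$, and $[\underline{x}\backslash\underline{s}]$ denotes simultaneous substitution. Rule $D^\mathrm{fcs}_\mathrm{L}$: from $$a_1=t_1[\underline{x}\backslash\underline{\zeta}],\ldots,a_r=t_r[\underline{x}\backslash\underline{\zeta}],A_1[\underline{x}\backslash\underline{\zeta}],\ldots,A_m[\underline{x}\backslash\underline{\zeta}],\Gamma\rightarrow\Delta$$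 infer $D(a_1,\ldots,a_r),\Gamma\rightarrow\Delta$, where $\underline{\zeta}=(\zeta_1,\ldots,\zeta_n)$ are pairwise distinct eigenvariables, i.e. variables not occurring free in the conclusion. Rule $D^\mathrm{fcs}_\mathrm{R}$: from the $m$ premises $\Gamma\rightarrow\Delta,A_1[\underline{x}\backslash\underline{u}]$, $\ldots$, $\Gamma\rightarrow\Delta,A_m[\underline{x}\backslash\underline{u}]$ infer $$\Gamma\rightarrow\Delta,D(t_1[\underline{x}\backslash\underline{u}],\ldots,t_r[\underline{x}\backslash\underline{u}]),$$ where $\underline{u}=(u_1,\ldots,u_n)$ are arbitrary terms. *)

theory Defs
  imports Main "HOL-Library.Multiset"
begin

text \<open>
  First-order syntax with de Bruijn indices: an index that is not bound by an enclosing quantifier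
  is a free variable. Formulas are thus identified up to renaming of bound variables, and the
  substitution \<open>fsubst\<close> is capture-avoiding. Equality is a logical symbol.
\<close>

datatype 'f tm = Var nat | Fn 'f "'f tm list"

datatype ('f, 'p) fm =
    Eq "'f tm" "'f tm"
  | Pred 'p "'f tm list"
  | Neg "('f, 'p) fm"
  | And "('f, 'p) fm" "('f, 'p) fm"
  | Or "('f, 'p) fm" "('f, 'p) fm"
  | Imp "('f, 'p) fm" "('f, 'p) fm"
  | All "('f, 'p) fm"
  | Ex "('f, 'p) fm"

fun is_atom :: "('f, 'p) fm \<Rightarrow> bool" where
  "is_atom (Eq _ _) = True"
| "is_atom (Pred _ _) = True"
| "is_atom _ = False"

text \<open>
  A language assigns arities to its symbols; \<open>None\<close> means that the symbol does not belong to it.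
\<close>

record ('f, 'p) language =
  funs :: "'f \<rightharpoonup> nat"
  preds :: "'p \<rightharpoonup> nat"

definition add_pred :: "('f, 'p) language \<Rightarrow> 'p \<Rightarrow> nat \<Rightarrow> ('f, 'p) language" where
  "add_pred L D r = L\<lparr>preds := (preds L)(D \<mapsto> r)\<rparr>"

fun wf_tm :: "('f, 'p) language \<Rightarrow> 'f tm \<Rightarrow> bool" where
  "wf_tm L (Var i) \<longleftrightarrow> True"
| "wf_tm L (Fn f ts) \<longleftrightarrow> funs L f = Some (length ts) \<and> (\<forall>t\<in>set ts. wf_tm L t)"

fun wf_fm :: "('f, 'p) language \<Rightarrow> ('f, 'p) fm \<Rightarrow> bool" where
  "wf_fm L (Eq s t) \<longleftrightarrow> wf_tm L s \<and> wf_tm L t"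
| "wf_fm L (Pred p ts) \<longleftrightarrow> preds L p = Some (length ts) \<and> (\<forall>t\<in>set ts. wf_tm L t)"
| "wf_fm L (Neg A) \<longleftrightarrow> wf_fm L A"
| "wf_fm L (And A B) \<longleftrightarrow> wf_fm L A \<and> wf_fm L B"
| "wf_fm L (Or A B) \<longleftrightarrow> wf_fm L A \<and> wf_fm L B"
| "wf_fm L (Imp A B) \<longleftrightarrow> wf_fm L A \<and> wf_fm L B"
| "wf_fm L (All A) \<longleftrightarrow> wf_fm L A"
| "wf_fm L (Ex A) \<longleftrightarrow> wf_fm L A"

fun tfv :: "'f tm \<Rightarrow> nat set" where
  "tfv (Var i) = {i}"
| "tfv (Fn f ts) = (\<Union>t\<in>set ts. tfv t)"

fun fv :: "('f, 'p) fm \<Rightarrow> nat set" where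
  "fv (Eq s t) = tfv s \<union> tfv t"
| "fv (Pred p ts) = (\<Union>t\<in>set ts. tfv t)"
| "fv (Neg A) = fv A"
| "fv (And A B) = fv A \<union> fv B"
| "fv (Or A B) = fv A \<union> fv B"
| "fv (Imp A B) = fv A \<union> fv B"
| "fv (All A) = {i. Suc i \<in> fv A}"
| "fv (Ex A) = {i. Suc i \<in> fv A}"

fun tsubst :: "(nat \<Rightarrow> 'f tm) \<Rightarrow> 'f tm \<Rightarrow> 'f tm" where
  "tsubst \<sigma> (Var i) = \<sigma> i"
| "tsubst \<sigma> (Fn f ts) = Fn f (map (tsubst \<sigma>) ts)"

definition up :: "(nat \<Rightarrow> 'f tm) \<Rightarrow> nat \<Rightarrow> 'f tm" where
  "up \<sigma> = case_nat (Var 0) (\<lambda>i. tsubst (\<lambda>j. Var (Suc j)) (\<sigma> i))"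

fun fsubst :: "(nat \<Rightarrow> 'f tm) \<Rightarrow> ('f, 'p) fm \<Rightarrow> ('f, 'p) fm" where
  "fsubst \<sigma> (Eq s t) = Eq (tsubst \<sigma> s) (tsubst \<sigma> t)"
| "fsubst \<sigma> (Pred p ts) = Pred p (map (tsubst \<sigma>) ts)"
| "fsubst \<sigma> (Neg A) = Neg (fsubst \<sigma> A)"
| "fsubst \<sigma> (And A B) = And (fsubst \<sigma> A) (fsubst \<sigma> B)"
| "fsubst \<sigma> (Or A B) = Or (fsubst \<sigma> A) (fsubst \<sigma> B)"
| "fsubst \<sigma> (Imp A B) = Imp (fsubst \<sigma> A) (fsubst \<sigma> B)"
| "fsubst \<sigma> (All A) = All (fsubst (up \<sigma>) A)"
| "fsubst \<sigma> (Ex A) = Ex (fsubst (up \<sigma>) A)"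

text \<open>
  \<open>inst t A\<close> is the instance by \<open>t\<close> of the matrix \<open>A\<close> of a quantified formula; the remaining
  indices drop by one because the quantifier disappears.
\<close>

definition inst :: "'f tm \<Rightarrow> ('f, 'p) fm \<Rightarrow> ('f, 'p) fm" where
  "inst t = fsubst (case_nat t Var)"

text \<open>
  Simultaneous substitution of \<open>us ! i\<close> for the free variable \<open>i\<close>, for all \<open>i < length us\<close>;
  the other free variables are unchanged.
\<close>

definition sim :: "'f tm list \<Rightarrow> nat \<Rightarrow> 'f tm" where
  "sim us i = (if i < length us then us ! i else Var i)"

text \<open>
  Sequents are pairs of multisets, so that the exchange rules are implicit.
\<close>

datatype ('f, 'p) sequent =
  Sequent "('f, 'p) fm multiset" "('f, 'p) fm multiset"  (infix "\<Rrightarrow>" 50)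

fun wf_seq :: "('f, 'p) language \<Rightarrow> ('f, 'p) sequent \<Rightarrow> bool" where
  "wf_seq L (\<Gamma> \<Rrightarrow> \<Delta>) \<longleftrightarrow> (\<forall>A\<in>#\<Gamma> + \<Delta>. wf_fm L A)"

fun fv_seq :: "('f, 'p) sequent \<Rightarrow> nat set" where
  "fv_seq (\<Gamma> \<Rrightarrow> \<Delta>) = (\<Union>A\<in>set_mset (\<Gamma> + \<Delta>). fv A)"

text \<open>
  \<open>LK L X\<close> is Gentzen's calculus LK (with cut) with the usual initial sequents for equality over
  the language \<open>L\<close>, extended by the rule instances \<open>X\<close>, where \<open>X Ps S\<close> means that \<open>S\<close> may be
  inferred from the list \<open>Ps\<close> of premises. All derivable sequents are sequents over \<open>L\<close>;
  well-formedness is required explicitly wherever it is not inherited from the premises.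
  In the rules \<open>AllR\<close> and \<open>ExL\<close> the free variable \<open>y\<close> is the eigenvariable.
\<close>

inductive LK ::
  "('f, 'p) language \<Rightarrow> (('f, 'p) sequent list \<Rightarrow> ('f, 'p) sequent \<Rightarrow> bool)
    \<Rightarrow> ('f, 'p) sequent \<Rightarrow> bool"
  for L X where
  Ax: "wf_fm L A \<Longrightarrow> LK L X ({#A#} \<Rrightarrow> {#A#})"
| EqRefl: "wf_tm L t \<Longrightarrow> LK L X ({#} \<Rrightarrow> {#Eq t t#})"
| EqFun: "length ss = length ts \<Longrightarrow> wf_tm L (Fn f ss) \<Longrightarrow> wf_tm L (Fn f ts) \<Longrightarrow>
    LK L X (mset (map2 Eq ss ts) \<Rrightarrow> {#Eq (Fn f ss) (Fn f ts)#})"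
| EqPred: "length ss = length ts \<Longrightarrow> wf_fm L (Pred p ss) \<Longrightarrow> wf_fm L (Pred p ts) \<Longrightarrow>
    LK L X (add_mset (Pred p ss) (mset (map2 Eq ss ts)) \<Rrightarrow> {#Pred p ts#})"
| EqEq: "wf_fm L (Eq s\<^sub>1 s\<^sub>2) \<Longrightarrow> wf_fm L (Eq t\<^sub>1 t\<^sub>2) \<Longrightarrow>
    LK L X ({#Eq s\<^sub>1 t\<^sub>1, Eq s\<^sub>2 t\<^sub>2, Eq s\<^sub>1 s\<^sub>2#} \<Rrightarrow> {#Eq t\<^sub>1 t\<^sub>2#})"
| WeakL: "LK L X (\<Gamma> \<Rrightarrow> \<Delta>) \<Longrightarrow> wf_fm L A \<Longrightarrow> LK L X (add_mset A \<Gamma> \<Rrightarrow> \<Delta>)"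
| WeakR: "LK L X (\<Gamma> \<Rrightarrow> \<Delta>) \<Longrightarrow> wf_fm L A \<Longrightarrow> LK L X (\<Gamma> \<Rrightarrow> add_mset A \<Delta>)"
| ContrL: "LK L X (add_mset A (add_mset A \<Gamma>) \<Rrightarrow> \<Delta>) \<Longrightarrow> LK L X (add_mset A \<Gamma> \<Rrightarrow> \<Delta>)"
| ContrR: "LK L X (\<Gamma> \<Rrightarrow> add_mset A (add_mset A \<Delta>)) \<Longrightarrow> LK L X (\<Gamma> \<Rrightarrow> add_mset A \<Delta>)"
| Cut: "LK L X (\<Gamma> \<Rrightarrow> add_mset A \<Delta>) \<Longrightarrow> LK L X (add_mset A \<Pi> \<Rrightarrow> \<Lambda>) \<Longrightarrow>
    LK L X (\<Gamma> + \<Pi> \<Rrightarrow> \<Delta> + \<Lambda>)"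
| NegL: "LK L X (\<Gamma> \<Rrightarrow> add_mset A \<Delta>) \<Longrightarrow> LK L X (add_mset (Neg A) \<Gamma> \<Rrightarrow> \<Delta>)"
| NegR: "LK L X (add_mset A \<Gamma> \<Rrightarrow> \<Delta>) \<Longrightarrow> LK L X (\<Gamma> \<Rrightarrow> add_mset (Neg A) \<Delta>)"
| AndL1: "LK L X (add_mset A \<Gamma> \<Rrightarrow> \<Delta>) \<Longrightarrow> wf_fm L B \<Longrightarrow>
    LK L X (add_mset (And A B) \<Gamma> \<Rrightarrow> \<Delta>)"
| AndL2: "LK L X (add_mset B \<Gamma> \<Rrightarrow> \<Delta>) \<Longrightarrow> wf_fm L A \<Longrightarrow>
    LK L X (add_mset (And A B) \<Gamma> \<Rrightarrow> \<Delta>)"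
| AndR: "LK L X (\<Gamma> \<Rrightarrow> add_mset A \<Delta>) \<Longrightarrow> LK L X (\<Gamma> \<Rrightarrow> add_mset B \<Delta>) \<Longrightarrow>
    LK L X (\<Gamma> \<Rrightarrow> add_mset (And A B) \<Delta>)"
| OrL: "LK L X (add_mset A \<Gamma> \<Rrightarrow> \<Delta>) \<Longrightarrow> LK L X (add_mset B \<Gamma> \<Rrightarrow> \<Delta>) \<Longrightarrow>
    LK L X (add_mset (Or A B) \<Gamma> \<Rrightarrow> \<Delta>)"
| OrR1: "LK L X (\<Gamma> \<Rrightarrow> add_mset A \<Delta>) \<Longrightarrow> wf_fm L B \<Longrightarrow>
    LK L X (\<Gamma> \<Rrightarrow> add_mset (Or A B) \<Delta>)"
| OrR2: "LK L X (\<Gamma> \<Rrightarrow> add_mset B \<Delta>) \<Longrightarrow> wf_fm L A \<Longrightarrow>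
    LK L X (\<Gamma> \<Rrightarrow> add_mset (Or A B) \<Delta>)"
| ImpL: "LK L X (\<Gamma> \<Rrightarrow> add_mset A \<Delta>) \<Longrightarrow> LK L X (add_mset B \<Pi> \<Rrightarrow> \<Lambda>) \<Longrightarrow>
    LK L X (add_mset (Imp A B) (\<Gamma> + \<Pi>) \<Rrightarrow> \<Delta> + \<Lambda>)"
| ImpR: "LK L X (add_mset A \<Gamma> \<Rrightarrow> add_mset B \<Delta>) \<Longrightarrow> LK L X (\<Gamma> \<Rrightarrow> add_mset (Imp A B) \<Delta>)"
| AllL: "LK L X (add_mset (inst t A) \<Gamma> \<Rrightarrow> \<Delta>) \<Longrightarrow> wf_tm L t \<Longrightarrow>
    LK L X (add_mset (All A) \<Gamma> \<Rrightarrow> \<Delta>)"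
| AllR: "LK L X (\<Gamma> \<Rrightarrow> add_mset (inst (Var y) A) \<Delta>) \<Longrightarrow>
    y \<notin> fv_seq (\<Gamma> \<Rrightarrow> add_mset (All A) \<Delta>) \<Longrightarrow> LK L X (\<Gamma> \<Rrightarrow> add_mset (All A) \<Delta>)"
| ExL: "LK L X (add_mset (inst (Var y) A) \<Gamma> \<Rrightarrow> \<Delta>) \<Longrightarrow>
    y \<notin> fv_seq (add_mset (Ex A) \<Gamma> \<Rrightarrow> \<Delta>) \<Longrightarrow> LK L X (add_mset (Ex A) \<Gamma> \<Rrightarrow> \<Delta>)"
| ExR: "LK L X (\<Gamma> \<Rrightarrow> add_mset (inst t A) \<Delta>) \<Longrightarrow> wf_tm L t \<Longrightarrow>
    LK L X (\<Gamma> \<Rrightarrow> add_mset (Ex A) \<Delta>)"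
| Extra: "X Ps S \<Longrightarrow> (\<forall>P\<in>set Ps. LK L X P) \<Longrightarrow> wf_seq L S \<Longrightarrow> LK L X S"

definition LKe :: "('f, 'p) language \<Rightarrow> ('f, 'p) sequent \<Rightarrow> bool" where
  "LKe L = LK L (\<lambda>Ps S. False)"

text \<open>
  In \<open>ts\<close> and \<open>As\<close> the variables \<open>x\<^sub>1, \<dots>, x\<^sub>n\<close> are represented by the indices \<open>n - 1, \<dots>, 0\<close>,
  so that \<open>(Ex ^^ n)\<close> binds them in this order, \<open>x\<^sub>1\<close> outermost. Accordingly the lists \<open>\<zeta>s\<close> and \<open>us\<close>
  below enumerate the values for \<open>x\<^sub>n, \<dots>, x\<^sub>1\<close>.
\<close>

inductive fcs_rule ::
  "('f, 'p) language \<Rightarrow> 'p \<Rightarrow> nat \<Rightarrow> 'f tm list \<Rightarrow> ('f, 'p) fm list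
    \<Rightarrow> ('f, 'p) sequent list \<Rightarrow> ('f, 'p) sequent \<Rightarrow> bool"
  for L D n ts As where
  DL: "length as = length ts \<Longrightarrow> length \<zeta>s = n \<Longrightarrow> distinct \<zeta>s \<Longrightarrow>
    set \<zeta>s \<inter> fv_seq (add_mset (Pred D as) \<Gamma> \<Rrightarrow> \<Delta>) = {} \<Longrightarrow>
    fcs_rule L D n ts As
      [mset (map2 (\<lambda>a t. Eq a (tsubst (sim (map Var \<zeta>s)) t)) as ts)
        + mset (map (fsubst (sim (map Var \<zeta>s))) As) + \<Gamma> \<Rrightarrow> \<Delta>]
      (add_mset (Pred D as) \<Gamma> \<Rrightarrow> \<Delta>)"
| DR: "length us = n \<Longrightarrow> \<forall>u\<in>set us. wf_tm L u \<Longrightarrow>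
    fcs_rule L D n ts As
      (map (\<lambda>A. \<Gamma> \<Rrightarrow> add_mset (fsubst (sim us) A) \<Delta>) As)
      (\<Gamma> \<Rrightarrow> add_mset (Pred D (map (tsubst (sim us)) ts)) \<Delta>)"

definition LKe_fcs ::
  "('f, 'p) language \<Rightarrow> 'p \<Rightarrow> nat \<Rightarrow> 'f tm list \<Rightarrow> ('f, 'p) fm list
    \<Rightarrow> ('f, 'p) sequent \<Rightarrow> bool" where
  "LKe_fcs L D n ts As =
    (let L' = add_pred L D (length ts) in LK L' (fcs_rule L' D n ts As))"

definition proves :: "(('f, 'p) sequent \<Rightarrow> bool) \<Rightarrow> ('f, 'p) fm \<Rightarrow> bool"  (infix "\<turnstile>" 50) where
  "C \<turnstile> \<psi> \<longleftrightarrow> C ({#} \<Rrightarrow> {#\<psi>#})"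

text \<open>
  There is no logical constant for truth; the empty conjunction is \<open>\<forall>x. x = x\<close>.
\<close>

fun conj_list :: "('f, 'p) fm list \<Rightarrow> ('f, 'p) fm" where
  "conj_list [] = All (Eq (Var 0) (Var 0))"
| "conj_list [A] = A"
| "conj_list (A # B # As) = And A (conj_list (B # As))"

text \<open>
  The formula \<open>\<phi>(a\<^sub>1, \<dots>, a\<^sub>r)\<close>: the argument places \<open>a\<^sub>1, \<dots>, a\<^sub>r\<close> are its free variables
  \<open>0, \<dots>, r - 1\<close>, which are the indices \<open>n, \<dots>, n + r - 1\<close> below the \<open>n\<close> quantifiers.
\<close>

definition fcs_fm :: "nat \<Rightarrow> 'f tm list \<Rightarrow> ('f, 'p) fm list \<Rightarrow> ('f, 'p) fm" where
  "fcs_fm n ts As =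
    (Ex ^^ n) (conj_list (map (\<lambda>j. Eq (Var (n + j)) (ts ! j)) [0..<length ts] @ As))"

text \<open>
  \<open>replace D \<phi> \<psi>\<close> is \<open>\<psi>\<close> with every \<open>D(s\<^sub>1, \<dots>, s\<^sub>r)\<close> replaced by \<open>\<phi>(s\<^sub>1, \<dots>, s\<^sub>r)\<close>. It is meant for
  formulas \<open>\<phi>\<close> whose free variables are all argument places, that is, below \<open>r\<close>; any further
  free variable would have to be shifted under the quantifiers of \<open>\<psi>\<close>.
\<close>

fun replace :: "'p \<Rightarrow> ('f, 'p) fm \<Rightarrow> ('f, 'p) fm \<Rightarrow> ('f, 'p) fm" where
  "replace D \<phi> (Eq s t) = Eq s t"
| "replace D \<phi> (Pred p ss) = (if p = D then fsubst (sim ss) \<phi> else Pred p ss)"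
| "replace D \<phi> (Neg A) = Neg (replace D \<phi> A)"
| "replace D \<phi> (And A B) = And (replace D \<phi> A) (replace D \<phi> B)"
| "replace D \<phi> (Or A B) = Or (replace D \<phi> A) (replace D \<phi> B)"
| "replace D \<phi> (Imp A B) = Imp (replace D \<phi> A) (replace D \<phi> B)"
| "replace D \<phi> (All A) = All (replace D \<phi> A)"
| "replace D \<phi> (Ex A) = Ex (replace D \<phi> A)"

end

theory Submission
  imports Defs
begin

text \<open>
  The two rules for \<open>D\<close> are exactly the left and right introduction rules that LK with equality
  already derives for the existential formula \<open>\<phi>\<close>: a block of existential quantifiers over a
  conjunction is introduced on the left by assuming the conjuncts for fresh eigenvariables, and on
  the right by proving them for some terms (\<open>LK_phiL\<close>, \<open>LK_phiR\<close>). In the right rule for \<open>D\<close>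
  the arguments are literally \<open>t\<^sub>1, \<dots>, t\<^sub>r\<close> at these terms, so that the equations among the
  conjuncts are instances of reflexivity.

  From left to right, every derivation that uses \<open>D\<close> is therefore translated step by step, by
  replacing \<open>D\<close> with \<open>\<phi>\<close> in all its sequents (\<open>LK_replace\<close>). Replacement commutes with
  substitution and adds no free variables, so the logical rules and their eigenvariable conditions
  survive. Apart from the rules for \<open>D\<close>, only the equality axiom for \<open>D\<close> needs an argument: \<open>\<phi>\<close> respects
  equality in its argument places because these occur in it only as left sides of equations
  (\<open>LK_phi_congruence\<close>).

  From right to left, a derivation of the replaced formula is also one in the larger calculus. There
  \<open>D(a\<^sub>1, \<dots>, a\<^sub>r)\<close> and \<open>\<phi>(a\<^sub>1, \<dots>, a\<^sub>r)\<close> entail each other (\<open>fcs_entails_phi\<close>), hence so do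
  every formula and its replacement (\<open>fcs_entails_replace\<close>), and one cut recovers the formula.
\<close>

section \<open>Substitution\<close>

lemma tsubst_cong: "(\<And>i. i \<in> tfv t \<Longrightarrow> \<sigma> i = \<tau> i) \<Longrightarrow> tsubst \<sigma> t = tsubst \<tau> t"
  by (induction t) auto

lemma tsubst_tsubst: "tsubst \<sigma> (tsubst \<tau> t) = tsubst (\<lambda>i. tsubst \<sigma> (\<tau> i)) t"
  by (induction t) auto

lemma tsubst_Var: "tsubst Var t = t"
  by (induction t) (auto simp: map_idI)

lemma tfv_tsubst: "tfv (tsubst \<sigma> t) = (\<Union>i\<in>tfv t. tfv (\<sigma> i))"
  by (induction t) auto

lemma wf_tm_tsubst: "wf_tm L t \<Longrightarrow> (\<And>i. i \<in> tfv t \<Longrightarrow> wf_tm L (\<sigma> i)) \<Longrightarrow> wf_tm L (tsubst \<sigma> t)"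
  by (induction t) auto

lemma wf_tm_tsubstD: "wf_tm L (tsubst \<sigma> t) \<Longrightarrow> wf_tm L t"
  by (induction t) auto

lemma finite_tfv: "finite (tfv t)"
  by (induction t) auto

lemma up_0 [simp]: "up \<sigma> 0 = Var 0"
  by (simp add: up_def)

lemma up_Suc [simp]: "up \<sigma> (Suc i) = tsubst (\<lambda>j. Var (Suc j)) (\<sigma> i)"
  by (simp add: up_def)

lemma up_Var [simp]: "up Var = Var"
  by (auto simp: up_def fun_eq_iff split: nat.split)

lemma tsubst_up: "tsubst (up \<sigma>) (up \<tau> i) = up (\<lambda>i. tsubst \<sigma> (\<tau> i)) i"
  by (cases i) (simp_all add: tsubst_tsubst)

lemma fsubst_cong: "(\<And>i. i \<in> fv A \<Longrightarrow> \<sigma> i = \<tau> i) \<Longrightarrow> fsubst \<sigma> A = fsubst \<tau> A"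
proof (induction A arbitrary: \<sigma> \<tau>)
  case (Eq s t)
  then show ?case by (simp add: tsubst_cong[of _ \<sigma> \<tau>])
next
  case (Pred p ss)
  then show ?case by (auto intro!: tsubst_cong)
next
  case (Neg A)
  show ?case using Neg.IH[of \<sigma> \<tau>] Neg.prems by simp
next
  case (And A B)
  show ?case using And.IH[of \<sigma> \<tau>] And.prems by simp
next
  case (Or A B)
  show ?case using Or.IH[of \<sigma> \<tau>] Or.prems by simp
next
  case (Imp A B)
  show ?case using Imp.IH[of \<sigma> \<tau>] Imp.prems by simp
next
  case (All A)
  have "up \<sigma> i = up \<tau> i" if "i \<in> fv A" for i
    using that All.prems[of "i - 1"] by (cases i) simp_all
  then show ?case using All.IH[of "up \<sigma>" "up \<tau>"] by simp
next
  case (Ex A)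
  have "up \<sigma> i = up \<tau> i" if "i \<in> fv A" for i
    using that Ex.prems[of "i - 1"] by (cases i) simp_all
  then show ?case using Ex.IH[of "up \<sigma>" "up \<tau>"] by simp
qed

lemma fsubst_fsubst: "fsubst \<sigma> (fsubst \<tau> A) = fsubst (\<lambda>i. tsubst \<sigma> (\<tau> i)) A"
  by (induction A arbitrary: \<sigma> \<tau>) (auto simp: tsubst_tsubst tsubst_up)

lemma fsubst_Var: "fsubst Var A = A"
  by (induction A) (auto simp: tsubst_Var map_idI)

lemma Suc_mem_tfv_shift: "Suc i \<in> tfv (tsubst (\<lambda>j. Var (Suc j)) t) \<longleftrightarrow> i \<in> tfv t"
  by (auto simp: tfv_tsubst)

text \<open>
  The free variables of a quantified formula are the positive ones of its matrix, shifted down; this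
  is what \<open>up\<close> does to them.
\<close>

lemma Suc_mem_tfv_up:
  "(\<exists>j\<in>M. Suc i \<in> tfv (up \<sigma> j)) \<longleftrightarrow> (\<exists>j. Suc j \<in> M \<and> i \<in> tfv (\<sigma> j))" (is "?l \<longleftrightarrow> ?r")
proof
  assume ?l
  then obtain j where "j \<in> M" "Suc i \<in> tfv (up \<sigma> j)" by blast
  then show ?r by (cases j) (auto simp: Suc_mem_tfv_shift)
next
  assume ?r
  then obtain j where "Suc j \<in> M" "i \<in> tfv (\<sigma> j)" by blast
  then show ?l by (intro bexI[of _ "Suc j"]) (auto simp: Suc_mem_tfv_shift)
qed

lemma fv_fsubst: "fv (fsubst \<sigma> A) = (\<Union>i\<in>fv A. tfv (\<sigma> i))"
proof (induction A arbitrary: \<sigma>)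
  case (All A)
  then show ?case by (auto simp: Suc_mem_tfv_up)
next
  case (Ex A)
  then show ?case by (auto simp: Suc_mem_tfv_up)
qed (auto simp: tfv_tsubst)

lemma finite_fv: "finite (fv A)"
proof (induction A)
  case (All A)
  then show ?case using finite_vimageI[of "fv A" Suc] by (simp add: vimage_def)
next
  case (Ex A)
  then show ?case using finite_vimageI[of "fv A" Suc] by (simp add: vimage_def)
qed (auto simp: finite_tfv)

lemma finite_fv_seq: "finite (fv_seq S)"
  by (cases S) (auto simp: finite_fv)

lemma wf_tm_up: "(\<And>i. wf_tm L (\<sigma> i)) \<Longrightarrow> wf_tm L (up \<sigma> i)"
  by (cases i) (auto intro: wf_tm_tsubst)

lemma wf_fm_fsubst: "wf_fm L A \<Longrightarrow> (\<And>i. wf_tm L (\<sigma> i)) \<Longrightarrow> wf_fm L (fsubst \<sigma> A)"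
  by (induction A arbitrary: \<sigma>) (auto simp: wf_tm_up intro: wf_tm_tsubst)

lemma wf_fm_fsubstD: "wf_fm L (fsubst \<sigma> A) \<Longrightarrow> wf_fm L A"
  by (induction A arbitrary: \<sigma>) (auto dest: wf_tm_tsubstD)

lemma wf_fm_inst: "wf_tm L t \<Longrightarrow> wf_fm L (inst t A) \<longleftrightarrow> wf_fm L A"
  unfolding inst_def by (auto dest: wf_fm_fsubstD intro!: wf_fm_fsubst split: nat.split)

lemma wf_tm_sim: "\<forall>u\<in>set us. wf_tm L u \<Longrightarrow> wf_tm L (sim us i)"
  by (auto simp: sim_def)

text \<open>
  Under a quantifier, a substitution and the instantiation of the bound variable by \<open>u\<close> combine
  into one substitution.
\<close>

lemma inst_fsubst_up: "inst u (fsubst (up \<sigma>) A) = fsubst (case_nat u \<sigma>) A"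
  unfolding inst_def fsubst_fsubst
  by (rule fsubst_cong) (auto simp: up_def tsubst_tsubst tsubst_Var split: nat.split)

text \<open>
  The length assumption ensures that every free variable of \<open>A\<close> is an argument place. On any other
  free variable \<open>i\<close>, \<open>sim\<close> would yield \<open>Var i\<close>, to which only the left side applies \<open>\<sigma>\<close>.
\<close>

lemma fsubst_fsubst_sim:
  assumes "fv A \<subseteq> {..<length ss}"
  shows "fsubst \<sigma> (fsubst (sim ss) A) = fsubst (sim (map (tsubst \<sigma>) ss)) A"
  unfolding fsubst_fsubst using assms by (intro fsubst_cong) (auto simp: sim_def)

lemma fv_fsubst_sim: "fv A \<subseteq> {..<length ss} \<Longrightarrow> fv (fsubst (sim ss) A) \<subseteq> (\<Union>s\<in>set ss. tfv s)"
  by (fastforce simp: fv_fsubst sim_def split: if_splits)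

section \<open>Structural and derived rules\<close>

lemma LK_imp_wf_seq: "LK L X S \<Longrightarrow> wf_seq L S"
proof (induction rule: LK.induct)
  case (EqFun ss ts f)
  then show ?case using set_zip_leftD[of _ _ ss ts] set_zip_rightD[of _ _ ss ts] by fastforce
next
  case (EqPred ss ts p)
  then show ?case using set_zip_leftD[of _ _ ss ts] set_zip_rightD[of _ _ ss ts] by fastforce
qed (auto simp: wf_fm_inst)

lemma LK_mono:
  assumes "LK L X S"
    and "\<And>t. wf_tm L t \<Longrightarrow> wf_tm L' t" and "\<And>A. wf_fm L A \<Longrightarrow> wf_fm L' A"
    and "\<And>Ps S. X Ps S \<Longrightarrow> X' Ps S"
  shows "LK L' X' S"
  using assms(1)
proof (induction rule: LK.induct)
  case (Extra Ps S)
  have "wf_seq L' S" using Extra assms(3) by (cases S) auto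
  then show ?case using Extra assms(4) by (intro LK.Extra[of X' Ps]) auto
qed (rule LK.intros; (assumption | (rule assms(2,3), assumption)))+

lemma LK_weaken:
  assumes "LK L X (\<Gamma> \<Rrightarrow> \<Delta>)" "\<forall>A\<in>#\<Pi> + \<Lambda>. wf_fm L A"
  shows "LK L X (\<Pi> + \<Gamma> \<Rrightarrow> \<Lambda> + \<Delta>)"
proof -
  have "LK L X (\<Pi> + \<Gamma> \<Rrightarrow> \<Delta>)"
    using assms by (induction \<Pi>) (auto intro: WeakL)
  then show ?thesis
    using assms by (induction \<Lambda>) (auto intro: WeakR)
qed

lemma LK_contractL:
  "LK L X (\<Pi> + \<Gamma> \<Rrightarrow> \<Delta>) \<Longrightarrow> set_mset \<Pi> \<subseteq> set_mset \<Gamma> \<Longrightarrow> LK L X (\<Gamma> \<Rrightarrow> \<Delta>)"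
proof (induction \<Pi>)
  case (add A \<Pi>)
  then have "add_mset A (\<Pi> + \<Gamma> - {#A#}) = \<Pi> + \<Gamma>" by auto
  with add.prems(1) have "LK L X (add_mset A (add_mset A (\<Pi> + \<Gamma> - {#A#})) \<Rrightarrow> \<Delta>)" by simp
  then have "LK L X (add_mset A (\<Pi> + \<Gamma> - {#A#}) \<Rrightarrow> \<Delta>)" by (rule ContrL)
  with \<open>add_mset A (\<Pi> + \<Gamma> - {#A#}) = \<Pi> + \<Gamma>\<close> show ?case using add by simp
qed simp

lemma LK_contractR:
  "LK L X (\<Gamma> \<Rrightarrow> \<Lambda> + \<Delta>) \<Longrightarrow> set_mset \<Lambda> \<subseteq> set_mset \<Delta> \<Longrightarrow> LK L X (\<Gamma> \<Rrightarrow> \<Delta>)"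
proof (induction \<Lambda>)
  case (add A \<Lambda>)
  then have "add_mset A (\<Lambda> + \<Delta> - {#A#}) = \<Lambda> + \<Delta>" by auto
  with add.prems(1) have "LK L X (\<Gamma> \<Rrightarrow> add_mset A (add_mset A (\<Lambda> + \<Delta> - {#A#})))" by simp
  then have "LK L X (\<Gamma> \<Rrightarrow> add_mset A (\<Lambda> + \<Delta> - {#A#}))" by (rule ContrR)
  with \<open>add_mset A (\<Lambda> + \<Delta> - {#A#}) = \<Lambda> + \<Delta>\<close> show ?case using add by simp
qed simp

text \<open>
  Weakening and contraction together make multiplicities irrelevant: derivability depends only on
  the sets of formulas on both sides, and is monotone in them.
\<close>

lemma LK_structural:
  assumes "LK L X (\<Gamma> \<Rrightarrow> \<Delta>)" and "set_mset \<Gamma> \<subseteq> set_mset \<Gamma>'" and "set_mset \<Delta> \<subseteq> set_mset \<Delta>'"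
    and "wf_seq L (\<Gamma>' \<Rrightarrow> \<Delta>')"
  shows "LK L X (\<Gamma>' \<Rrightarrow> \<Delta>')"
proof -
  have "LK L X (\<Gamma>' + \<Gamma> \<Rrightarrow> \<Delta>' + \<Delta>)"
    using assms by (intro LK_weaken) auto
  then have "LK L X (\<Gamma> + \<Gamma>' \<Rrightarrow> \<Delta> + \<Delta>')" by (simp add: add.commute)
  then show ?thesis using assms LK_contractL LK_contractR by blast
qed

text \<open>
  The form of cut in which equations and atoms are supplied to an axiom: each formula of \<open>\<Pi>\<close> may be
  discharged when it is derivable in the same context.
\<close>

lemma LK_multicut:
  assumes "LK L X (\<Pi> + \<Gamma> \<Rrightarrow> \<Delta>)" and "\<And>A. A \<in># \<Pi> \<Longrightarrow> LK L X (\<Gamma> \<Rrightarrow> add_mset A \<Delta>)"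
  shows "LK L X (\<Gamma> \<Rrightarrow> \<Delta>)"
  using assms
proof (induction \<Pi>)
  case (add A \<Pi>)
  have "LK L X (\<Gamma> \<Rrightarrow> add_mset A \<Delta>)" "LK L X (add_mset A (\<Pi> + \<Gamma>) \<Rrightarrow> \<Delta>)"
    using add.prems by auto
  then have c: "LK L X (\<Gamma> + (\<Pi> + \<Gamma>) \<Rrightarrow> \<Delta> + \<Delta>)" by (rule Cut)
  then have "LK L X (\<Pi> + \<Gamma> \<Rrightarrow> \<Delta>)"
    using LK_imp_wf_seq[OF c] by (elim LK_structural) auto
  then show ?case using add by auto
qed simp

lemma LK_member:
  assumes "A \<in># \<Gamma>" "A \<in># \<Delta>" "wf_seq L (\<Gamma> \<Rrightarrow> \<Delta>)"
  shows "LK L X (\<Gamma> \<Rrightarrow> \<Delta>)"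
  using assms by (intro LK_structural[OF Ax[of L A]]) auto

text \<open>
  The equality axiom for \<open>=\<close> itself, applied to \<open>a = b\<close>, \<open>c = c\<close> and \<open>a = c\<close>; the second is cut
  away. Symmetry is the case \<open>c = a\<close>.
\<close>

lemma LK_Eq_euclidean:
  assumes "wf_tm L a" "wf_tm L b" "wf_tm L c"
  shows "LK L X ({#Eq a b, Eq a c#} \<Rrightarrow> {#Eq b c#})"
proof (rule LK_multicut[of L X "{#Eq c c#}"])
  show "LK L X ({#Eq c c#} + {#Eq a b, Eq a c#} \<Rrightarrow> {#Eq b c#})"
    using EqEq[of L a c b c X] assms by (simp add: add_mset_commute)
  show "LK L X ({#Eq a b, Eq a c#} \<Rrightarrow> add_mset A {#Eq b c#})" if "A \<in># {#Eq c c#}" for A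
    using that assms by (intro LK_structural[OF EqRefl[of L c]]) auto
qed

lemma LK_Eq_sym:
  assumes "wf_tm L a" "wf_tm L b"
  shows "LK L X ({#Eq a b#} \<Rrightarrow> {#Eq b a#})"
proof (rule LK_multicut[of L X "{#Eq a a#}"])
  show "LK L X ({#Eq a a#} + {#Eq a b#} \<Rrightarrow> {#Eq b a#})"
    using LK_Eq_euclidean[of L a b a X] assms by (simp add: add_mset_commute)
  show "LK L X ({#Eq a b#} \<Rrightarrow> add_mset A {#Eq b a#})" if "A \<in># {#Eq a a#}" for A
    using that assms by (intro LK_structural[OF EqRefl[of L a]]) auto
qed

text \<open>
  Entailment between single formulas is compatible with all connectives and quantifiers, negation
  and the left side of an implication reversing it. Induction on a formula therefore reduces the
  mutual entailment of a formula and its replacement to atoms.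
\<close>

abbreviation entails where
  "entails L X A B \<equiv> LK L X ({#A#} \<Rrightarrow> {#B#})"

lemma entails_Neg: "entails L X B A \<Longrightarrow> entails L X (Neg A) (Neg B)"
  using NegR[of L X B "{#Neg A#}" "{#}"] NegL[of L X "{#B#}" A "{#}"]
  by (simp add: add_mset_commute)

lemma entails_And:
  assumes "entails L X A A'" "entails L X B B'"
  shows "entails L X (And A B) (And A' B')"
proof -
  have "wf_fm L A" "wf_fm L B" using assms[THEN LK_imp_wf_seq] by auto
  then show ?thesis
    using AndL1[of L X A "{#}" "{#A'#}" B] AndL2[of L X B "{#}" "{#B'#}" A] assms
    by (intro AndR) auto
qed

lemma entails_Or:
  assumes "entails L X A A'" "entails L X B B'"
  shows "entails L X (Or A B) (Or A' B')"
proof -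
  have "wf_fm L A'" "wf_fm L B'" using assms[THEN LK_imp_wf_seq] by auto
  then show ?thesis
    using OrR1[of L X "{#A#}" A' "{#}" B'] OrR2[of L X "{#B#}" B' "{#}" A'] assms
    by (intro OrL) auto
qed

lemma entails_Imp:
  assumes "entails L X A' A" "entails L X B B'"
  shows "entails L X (Imp A B) (Imp A' B')"
  using ImpR[of L X A' "{#Imp A B#}" B' "{#}"] ImpL[of L X "{#A'#}" A "{#}" B "{#}" "{#B'#}"] assms
  by (simp add: add_mset_commute)

lemma ex_fresh: "\<exists>y. y \<notin> fv_seq S"
  using ex_new_if_finite[OF infinite_UNIV_nat finite_fv_seq] by blast

lemma entails_All:
  assumes "\<And>y. entails L X (inst (Var y) A) (inst (Var y) B)"
  shows "entails L X (All A) (All B)"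
proof -
  obtain y where "y \<notin> fv_seq ({#All A#} \<Rrightarrow> {#All B#})" using ex_fresh by blast
  then show ?thesis
    using AllL[of L X "Var y" A "{#}" "{#inst (Var y) B#}"] assms by (intro AllR) auto
qed

lemma entails_Ex:
  assumes "\<And>y. entails L X (inst (Var y) A) (inst (Var y) B)"
  shows "entails L X (Ex A) (Ex B)"
proof -
  obtain y where "y \<notin> fv_seq ({#Ex A#} \<Rrightarrow> {#Ex B#})" using ex_fresh by blast
  then show ?thesis
    using ExR[of L X "{#inst (Var y) A#}" "Var y" B "{#}"] assms by (intro ExL) auto
qed

section \<open>Finite conjunctions and blocks of existential quantifiers\<close>

lemma wf_fm_conj_list: "wf_fm L (conj_list As) \<longleftrightarrow> (\<forall>A\<in>set As. wf_fm L A)"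
  by (induction As rule: conj_list.induct) auto

lemma fsubst_conj_list: "fsubst \<sigma> (conj_list As) = conj_list (map (fsubst \<sigma>) As)"
  by (induction As rule: conj_list.induct) auto

lemma fv_conj_list: "fv (conj_list As) = (\<Union>A\<in>set As. fv A)"
  by (induction As rule: conj_list.induct) auto

lemma LK_conj_listL:
  "LK L X (mset As + \<Gamma> \<Rrightarrow> \<Delta>) \<Longrightarrow> LK L X (add_mset (conj_list As) \<Gamma> \<Rrightarrow> \<Delta>)"
proof (induction As arbitrary: \<Gamma> rule: conj_list.induct)
  case 1
  then show ?case by (auto intro: WeakL)
next
  case (3 A B As)
  let ?C = "conj_list (B # As)"
  have "LK L X (mset (B # As) + add_mset A \<Gamma> \<Rrightarrow> \<Delta>)"
    using "3.prems" by (simp add: add_mset_commute)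
  from "3.IH"[OF this] have *: "LK L X (add_mset A (add_mset ?C \<Gamma>) \<Rrightarrow> \<Delta>)"
    by (simp add: add_mset_commute)
  then have wf: "wf_fm L A" "wf_fm L ?C" by (auto dest: LK_imp_wf_seq)
  \<comment> \<open>each left rule consumes one conjunct, so the conjunction is introduced twice and contracted\<close>
  from AndL1[OF * wf(2)] have "LK L X (add_mset ?C (add_mset (And A ?C) \<Gamma>) \<Rrightarrow> \<Delta>)"
    by (simp add: add_mset_commute)
  from ContrL[OF AndL2[OF this wf(1)]] show ?case by simp
qed simp

lemma LK_conj_listR:
  assumes "\<And>A. A \<in> set As \<Longrightarrow> LK L X (\<Gamma> \<Rrightarrow> add_mset A \<Delta>)" "wf_seq L (\<Gamma> \<Rrightarrow> \<Delta>)"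
  shows "LK L X (\<Gamma> \<Rrightarrow> add_mset (conj_list As) \<Delta>)"
  using assms
proof (induction As rule: conj_list.induct)
  case 1
  have "LK L X ({#} \<Rrightarrow> {#All (Eq (Var 0) (Var 0))#})"
    by (rule AllR[where y = 0]) (auto simp: inst_def intro: EqRefl)
  then show ?case using 1 by (elim LK_structural) auto
qed (auto intro: AndR)

lemma wf_fm_Ex_funpow [simp]: "wf_fm L ((Ex ^^ n) A) = wf_fm L A"
  by (induction n) auto

lemma fv_Ex_funpow: "fv ((Ex ^^ n) A) = {i. i + n \<in> fv A}"
  by (induction n) auto

lemma fsubst_Ex_funpow: "fsubst \<sigma> ((Ex ^^ n) A) = (Ex ^^ n) (fsubst ((up ^^ n) \<sigma>) A)"
  by (induction n arbitrary: \<sigma>) (simp_all, simp add: funpow_swap1)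

text \<open>
  The substitution for the matrix of a block of quantifiers when the block is instantiated: the
  bound indices receive the terms of the list and the others drop by its length.
\<close>

fun multi_inst :: "'f tm list \<Rightarrow> nat \<Rightarrow> 'f tm" where
  "multi_inst [] = Var"
| "multi_inst (u # us) = case_nat u (multi_inst us)"

text \<open>
  After a substitution \<open>\<sigma>\<close> applied to a whole block of quantifiers, instantiating the block gives
  one substitution that sends the bound indices to \<open>us\<close> and the others where \<open>\<sigma>\<close> sends them.
\<close>

lemma tsubst_multi_inst_up:
  "tsubst (multi_inst us) ((up ^^ length us) \<sigma> i)
    = (if i < length us then us ! i else \<sigma> (i - length us))"
proof (induction us arbitrary: i)
  case (Cons u us)
  then show ?case by (cases i) (auto simp: tsubst_tsubst)
qed (simp add: tsubst_Var)

lemma fv_fsubst_multi_inst: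
  "fv (fsubst (multi_inst us) A) \<subseteq> (\<Union>u\<in>set us. tfv u) \<union> fv ((Ex ^^ length us) A)"
proof -
  have "tfv (multi_inst us i) \<subseteq> (\<Union>u\<in>set us. tfv u) \<union> {j. j + length us = i}" for i
  proof (induction us arbitrary: i)
    case (Cons u us)
    show ?case using Cons[of "i - 1"] by (cases i) auto
  qed simp
  then show ?thesis by (fastforce simp: fv_fsubst fv_Ex_funpow)
qed

text \<open>
  Going down the derivation, the innermost quantifier is introduced first, when the eigenvariables
  of the remaining ones still occur in its formula; this is why they have to be pairwise distinct.
\<close>

lemma LK_Ex_funpowL:
  assumes "LK L X (add_mset (fsubst (multi_inst (map Var \<zeta>s)) A) \<Gamma> \<Rrightarrow> \<Delta>)" and "distinct \<zeta>s"
    and "set \<zeta>s \<inter> fv_seq (add_mset ((Ex ^^ length \<zeta>s) A) \<Gamma> \<Rrightarrow> \<Delta>) = {}"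
  shows "LK L X (add_mset ((Ex ^^ length \<zeta>s) A) \<Gamma> \<Rrightarrow> \<Delta>)"
  using assms
proof (induction \<zeta>s arbitrary: A)
  case Nil
  then show ?case by (simp add: fsubst_Var)
next
  case (Cons \<zeta> \<zeta>s)
  let ?\<tau> = "multi_inst (map Var \<zeta>s)"
  have swap: "(Ex ^^ length (\<zeta> # \<zeta>s)) A = (Ex ^^ length \<zeta>s) (Ex A)"
    by (simp add: funpow_swap1)
  have "\<zeta> \<notin> fv (fsubst ?\<tau> (Ex A))"
    using Cons.prems(2,3) fv_fsubst_multi_inst[of "map Var \<zeta>s" "Ex A"] unfolding swap by auto
  moreover have "fsubst ?\<tau> (Ex A) = Ex (fsubst (up ?\<tau>) A)"
    by simp
  moreover have "LK L X (add_mset (inst (Var \<zeta>) (fsubst (up ?\<tau>) A)) \<Gamma> \<Rrightarrow> \<Delta>)"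
    using Cons.prems(1) by (simp add: inst_fsubst_up)
  ultimately have "LK L X (add_mset (fsubst ?\<tau> (Ex A)) \<Gamma> \<Rrightarrow> \<Delta>)"
    using Cons.prems(3) ExL[of L X \<zeta> "fsubst (up ?\<tau>) A" \<Gamma> \<Delta>] by auto
  then show ?case
    using Cons.prems(2,3) unfolding swap by (intro Cons.IH) auto
qed

lemma LK_Ex_funpowR:
  assumes "LK L X (\<Gamma> \<Rrightarrow> add_mset (fsubst (multi_inst us) A) \<Delta>)" and "\<forall>u\<in>set us. wf_tm L u"
  shows "LK L X (\<Gamma> \<Rrightarrow> add_mset ((Ex ^^ length us) A) \<Delta>)"
  using assms
proof (induction us arbitrary: A)
  case Nil
  then show ?case by (simp add: fsubst_Var)
next
  case (Cons u us)
  let ?\<tau> = "multi_inst us"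
  have "LK L X (\<Gamma> \<Rrightarrow> add_mset (inst u (fsubst (up ?\<tau>) A)) \<Delta>)"
    using Cons.prems(1) by (simp add: inst_fsubst_up)
  then have "LK L X (\<Gamma> \<Rrightarrow> add_mset (fsubst ?\<tau> (Ex A)) \<Delta>)"
    using ExR Cons.prems(2) by fastforce
  then have "LK L X (\<Gamma> \<Rrightarrow> add_mset ((Ex ^^ length us) (Ex A)) \<Delta>)"
    using Cons.prems(2) by (intro Cons.IH) auto
  then show ?case by (simp add: funpow_swap1)
qed

lemma ex_fresh_list:
  assumes "finite M"
  obtains \<zeta>s :: "nat list" where "length \<zeta>s = n" "distinct \<zeta>s" "set \<zeta>s \<inter> M = {}"
proof -
  have "infinite (UNIV - M)" using assms infinite_UNIV_nat by simp
  then obtain B where "finite B" "card B = n" "B \<subseteq> UNIV - M"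
    using infinite_arbitrarily_large by blast
  then show thesis
    using that finite_distinct_list[of B] distinct_card by (metis Diff_eq inf_commute inf_top.left_neutral disjoint_eq_subset_Compl Compl_eq_Diff_UNIV)
qed


section \<open>The defined predicate\<close>

lemma wf_tm_add_pred [simp]: "wf_tm (add_pred L D r) t \<longleftrightarrow> wf_tm L t"
  by (induction t) (auto simp: add_pred_def)

lemma preds_add_pred: "preds (add_pred L D r) p = (if p = D then Some r else preds L p)"
  by (simp add: add_pred_def)

locale conjunctive_definition =
  fixes L :: "('f, 'p) language" and D :: 'p and n :: nat
    and ts :: "'f tm list" and As :: "('f, 'p) fm list"
  assumes D_new: "D \<notin> dom (preds L)"
    and wf_ts: "t \<in> set ts \<Longrightarrow> wf_tm L t"
    and tfv_ts: "t \<in> set ts \<Longrightarrow> tfv t \<subseteq> {..<n}"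
    and wf_As: "A \<in> set As \<Longrightarrow> wf_fm L A"
    and fv_As: "A \<in> set As \<Longrightarrow> fv A \<subseteq> {..<n}"
begin

abbreviation LD :: "('f, 'p) language" where
  "LD \<equiv> add_pred L D (length ts)"

abbreviation \<phi> :: "('f, 'p) fm" where
  "\<phi> \<equiv> fcs_fm n ts As"

abbreviation unfold :: "('f, 'p) fm \<Rightarrow> ('f, 'p) fm" where
  "unfold \<equiv> replace D \<phi>"

text \<open>
  The conjuncts of the matrix of \<open>\<phi>(a\<^sub>1, \<dots>, a\<^sub>r)\<close> with the terms \<open>us\<close> for the bound variables, which
  are also the formulas that the left rule for \<open>D\<close> discharges.
\<close>

definition clauses :: "'f tm list \<Rightarrow> 'f tm list \<Rightarrow> ('f, 'p) fm list" where
  "clauses as us = map2 (\<lambda>a t. Eq a (tsubst (sim us) t)) as ts @ map (fsubst (sim us)) As"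

lemma wf_fm_LD: "wf_fm L A \<Longrightarrow> wf_fm LD A"
  using D_new by (induction A) (auto simp: preds_add_pred)

lemma wf_fm_clauses:
  assumes "\<forall>a\<in>set as. wf_tm L a" "\<forall>u\<in>set us. wf_tm L u" "B \<in> set (clauses as us)"
  shows "wf_fm L B"
  using assms wf_tm_sim[OF assms(2)]
  by (auto simp: clauses_def wf_ts wf_As intro!: wf_fm_fsubst wf_tm_tsubst
      elim!: in_set_zipE)

lemma fv_phi: "fv \<phi> \<subseteq> {..<length ts}"
proof
  fix i assume "i \<in> fv \<phi>"
  then consider j where "j < length ts" "i + n \<in> tfv (Var (n + j) :: 'f tm) \<union> tfv (ts ! j)"
    | A where "A \<in> set As" "i + n \<in> fv A"
    by (auto simp: fcs_fm_def fv_Ex_funpow fv_conj_list)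
  then show "i \<in> {..<length ts}"
    using tfv_ts[OF nth_mem] fv_As by cases fastforce+
qed

lemma wf_phi: "wf_fm L \<phi>"
  by (auto simp: fcs_fm_def wf_fm_conj_list wf_ts wf_As)

lemma wf_phi_instance: "\<forall>a\<in>set as. wf_tm L a \<Longrightarrow> wf_fm L (fsubst (sim as) \<phi>)"
  by (intro wf_fm_fsubst wf_phi wf_tm_sim)

text \<open>
  Later proofs use this description of \<open>\<phi>\<close> instead of its index arithmetic. The matrix \<open>M\<close> does not depend on
  \<open>us\<close>; hence the rules for blocks of quantifiers apply to it both with eigenvariables and with
  arbitrary terms.
\<close>

lemma phi_instance_eq_Ex_funpow:
  assumes "length as = length ts"
  obtains M where "fsubst (sim as) \<phi> = (Ex ^^ n) M"
    and "\<And>us. length us = n \<Longrightarrow> fsubst (multi_inst us) M = conj_list (clauses as us)"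
proof
  let ?Bs = "map (\<lambda>j. Eq (Var (n + j)) (ts ! j)) [0..<length ts] @ As"
  let ?M = "fsubst ((up ^^ n) (sim as)) (conj_list ?Bs)"
  show "fsubst (sim as) \<phi> = (Ex ^^ n) ?M"
    by (simp add: fcs_fm_def fsubst_Ex_funpow)
  fix us :: "'f tm list" assume us: "length us = n"
  let ?\<rho> = "\<lambda>i. if i < n then us ! i else sim as (i - n)"
  have "(\<lambda>i. tsubst (multi_inst us) ((up ^^ n) (sim as) i)) = ?\<rho>"
    using tsubst_multi_inst_up[of us "sim as"] us by auto
  then have *: "fsubst (multi_inst us) ?M = conj_list (map (fsubst ?\<rho>) ?Bs)"
    unfolding fsubst_fsubst by (simp only: fsubst_conj_list)
  moreover have "tsubst ?\<rho> t = tsubst (sim us) t" if "t \<in> set ts" for t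
    using tfv_ts[OF that] us by (intro tsubst_cong) (auto simp: sim_def)
  moreover have "fsubst ?\<rho> A = fsubst (sim us) A" if "A \<in> set As" for A
    using fv_As[OF that] us by (intro fsubst_cong) (auto simp: sim_def)
  ultimately have "map (fsubst ?\<rho>) ?Bs = clauses as us"
    using assms unfolding clauses_def map_append
    by (intro arg_cong2[of _ _ _ _ append] nth_equalityI) (auto simp: sim_def)
  with * show "fsubst (multi_inst us) ?M = conj_list (clauses as us)"
    by (simp only:)
qed

text \<open>
  This and the next lemma are the two rules for \<open>D\<close> with \<open>\<phi>\<close> in place of \<open>D\<close>, except that the right
  rule has arbitrary arguments \<open>as\<close> and hence also the equations for them among its premises. The
  language and the additional rules are arbitrary because both calculi of the theorem use these rules.
\<close>

lemma LK_phiL: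
  assumes "LK K X (mset (clauses as (map Var \<zeta>s)) + \<Gamma> \<Rrightarrow> \<Delta>)"
    and "length as = length ts" "length \<zeta>s = n" "distinct \<zeta>s"
    and "set \<zeta>s \<inter> fv_seq (add_mset (fsubst (sim as) \<phi>) \<Gamma> \<Rrightarrow> \<Delta>) = {}"
  shows "LK K X (add_mset (fsubst (sim as) \<phi>) \<Gamma> \<Rrightarrow> \<Delta>)"
proof -
  obtain M where M: "fsubst (sim as) \<phi> = (Ex ^^ n) M"
    "fsubst (multi_inst (map Var \<zeta>s)) M = conj_list (clauses as (map Var \<zeta>s))"
    using phi_instance_eq_Ex_funpow[OF assms(2)] assms(3) by (metis length_map)
  have "LK K X (add_mset (fsubst (multi_inst (map Var \<zeta>s)) M) \<Gamma> \<Rrightarrow> \<Delta>)"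
    unfolding M(2) by (rule LK_conj_listL[OF assms(1)])
  then show ?thesis
    using LK_Ex_funpowL[of K X \<zeta>s M \<Gamma> \<Delta>] assms(3-5) unfolding M(1) by simp
qed

lemma LK_phiR:
  assumes "\<And>B. B \<in> set (clauses as us) \<Longrightarrow> LK K X (\<Gamma> \<Rrightarrow> add_mset B \<Delta>)"
    and "length as = length ts" "length us = n" "\<forall>u\<in>set us. wf_tm K u" "wf_seq K (\<Gamma> \<Rrightarrow> \<Delta>)"
  shows "LK K X (\<Gamma> \<Rrightarrow> add_mset (fsubst (sim as) \<phi>) \<Delta>)"
proof -
  obtain M where M: "fsubst (sim as) \<phi> = (Ex ^^ n) M"
    "fsubst (multi_inst us) M = conj_list (clauses as us)"
    using phi_instance_eq_Ex_funpow[OF assms(2)] assms(3) by metis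
  have "LK K X (\<Gamma> \<Rrightarrow> add_mset (fsubst (multi_inst us) M) \<Delta>)"
    unfolding M(2) using assms(1,5) by (rule LK_conj_listR)
  from LK_Ex_funpowR[OF this assms(4)] show ?thesis
    unfolding M(1) by (simp add: assms(3))
qed

text \<open>
  The eigenvariables that witness \<open>\<phi>(a\<^sub>1, \<dots>, a\<^sub>r)\<close> also witness \<open>\<phi>(b\<^sub>1, \<dots>, b\<^sub>r)\<close>: the formulas \<open>As\<close>
  do not mention the arguments, and \<open>b\<^sub>i = t\<^sub>i\<close> follows from \<open>a\<^sub>i = b\<^sub>i\<close> and \<open>a\<^sub>i = t\<^sub>i\<close>.
\<close>

lemma LK_phi_congruence:
  assumes "length as = length ts" "length bs = length ts"
    and as: "\<forall>a\<in>set as. wf_tm L a" and bs: "\<forall>b\<in>set bs. wf_tm L b"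
  shows "LK L X (add_mset (fsubst (sim as) \<phi>) (mset (map2 Eq as bs)) \<Rrightarrow> {#fsubst (sim bs) \<phi>#})"
proof -
  let ?E = "mset (map2 Eq as bs) :: ('f, 'p) fm multiset"
  obtain \<zeta>s where \<zeta>s: "length \<zeta>s = n" "distinct \<zeta>s"
    "set \<zeta>s \<inter> fv_seq (add_mset (fsubst (sim as) \<phi>) ?E \<Rrightarrow> {#fsubst (sim bs) \<phi>#}) = {}"
    using ex_fresh_list finite_fv_seq by blast
  let ?us = "map Var \<zeta>s :: 'f tm list"
  let ?\<Gamma> = "mset (clauses as ?us) + ?E"
  have wf: "wf_seq L (?\<Gamma> \<Rrightarrow> {#})"
    using as bs wf_fm_clauses[OF as, of ?us] by (auto elim!: in_set_zipE)
  have "LK L X (?\<Gamma> \<Rrightarrow> {#B#})" if B: "B \<in> set (clauses bs ?us)" for B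
  proof -
    have wfB: "wf_fm L B" using wf_fm_clauses[OF bs, of ?us] B by auto
    from B consider i where "i < length ts" "B = Eq (bs ! i) (tsubst (sim ?us) (ts ! i))"
      | "B \<in> set (map (fsubst (sim ?us)) As)"
      using assms(2) by (auto simp: clauses_def in_set_zip)
    then show ?thesis
    proof cases
      case 1
      let ?t = "tsubst (sim ?us) (ts ! i)"
      have "Eq (as ! i) (bs ! i) \<in># ?\<Gamma>" "Eq (as ! i) ?t \<in># ?\<Gamma>"
        using 1 assms(1,2) by (force simp: clauses_def in_set_zip)+
      then show ?thesis
        using 1 wf wfB as bs assms(1,2)
        by (intro LK_structural[OF LK_Eq_euclidean[of L "as ! i" "bs ! i" ?t]]) auto
    next
      case 2
      then have "B \<in># ?\<Gamma>" by (auto simp: clauses_def)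
      then show ?thesis using wf wfB by (intro LK_member[of B]) auto
    qed
  qed
  then have "LK L X (?\<Gamma> \<Rrightarrow> {#fsubst (sim bs) \<phi>#})"
    using assms(2) \<zeta>s(1) wf by (intro LK_phiR[of bs ?us]) auto
  then show ?thesis
    using assms(1) \<zeta>s by (intro LK_phiL[of L X as \<zeta>s]) auto
qed

text \<open>
  Well-formedness enters only through the number of arguments of \<open>D\<close>: with too few of them, a
  free variable of \<open>\<phi>\<close> would be left over as a free variable of the result. The same holds for the
  next two facts on free variables and instances.
\<close>

lemma replace_fsubst: "wf_fm LD A \<Longrightarrow> unfold (fsubst \<sigma> A) = fsubst \<sigma> (unfold A)"
proof (induction A arbitrary: \<sigma>)
  case (Pred p ss)
  then show ?case using fv_phi by (auto simp: preds_add_pred fsubst_fsubst_sim)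
qed auto

lemma replace_inst: "wf_fm LD A \<Longrightarrow> unfold (inst t A) = inst t (unfold A)"
  by (simp add: inst_def replace_fsubst)

lemma fv_replace: "wf_fm LD A \<Longrightarrow> fv (unfold A) \<subseteq> fv A"
proof (induction A)
  case (Pred p ss)
  then show ?case using fv_fsubst_sim[of \<phi> ss] fv_phi by (cases "p = D") (simp_all add: preds_add_pred)
qed auto

lemma wf_fm_replace: "wf_fm LD A \<Longrightarrow> wf_fm L (unfold A)"
proof (induction A)
  case (Pred p ss)
  then show ?case by (cases "p = D") (auto simp: preds_add_pred wf_phi_instance)
qed auto

lemma replace_id: "wf_fm L A \<Longrightarrow> unfold A = A"
  using D_new by (induction A) auto

section \<open>Derivations with the rules for the defined predicate\<close>

fun replace_seq :: "('f, 'p) sequent \<Rightarrow> ('f, 'p) sequent" where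
  "replace_seq (\<Gamma> \<Rrightarrow> \<Delta>) = (image_mset unfold \<Gamma> \<Rrightarrow> image_mset unfold \<Delta>)"

lemma fv_replace_seq: "wf_seq LD S \<Longrightarrow> fv_seq (replace_seq S) \<subseteq> fv_seq S"
  using fv_replace by (cases S) fastforce

lemma wf_replace_seq: "wf_seq LD S \<Longrightarrow> wf_seq L (replace_seq S)"
  using wf_fm_replace by (cases S) auto

text \<open>
  \<open>D\<close> is new, so replacement does not touch the formulas that its own left rule discharges; the
  definition is not recursive.
\<close>

lemma replace_clauses:
  assumes "B \<in> set (clauses as us)"
  shows "unfold B = B"
  using assms wf_As wf_fm_LD by (auto simp: clauses_def replace_fsubst replace_id)

lemma replace_map2_Eq: "image_mset unfold (mset (map2 Eq ss us)) = mset (map2 Eq ss us)"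
  by (rule multiset.map_ident_strong) auto

lemma LK_replace_fcs_rule:
  assumes "fcs_rule LD D n ts As Ps S" "\<forall>P\<in>set Ps. LK L X (replace_seq P)" "wf_seq LD S"
  shows "LK L X (replace_seq S)"
  using assms(1)
proof cases
  case (DL as \<zeta>s \<Gamma> \<Delta>)
  let ?G = "image_mset unfold \<Gamma>" and ?D = "image_mset unfold \<Delta>"
  have "image_mset unfold (mset (clauses as (map Var \<zeta>s))) = mset (clauses as (map Var \<zeta>s))"
    by (rule multiset.map_ident_strong) (simp add: replace_clauses)
  then have "LK L X (mset (clauses as (map Var \<zeta>s)) + ?G \<Rrightarrow> ?D)"
    using assms(2) DL(1) by (simp add: clauses_def)
  moreover have "set \<zeta>s \<inter> fv_seq (add_mset (fsubst (sim as) \<phi>) ?G \<Rrightarrow> ?D) = {}"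
  proof -
    have "fv_seq (add_mset (fsubst (sim as) \<phi>) ?G \<Rrightarrow> ?D) \<subseteq> fv_seq S"
      using fv_replace_seq[OF assms(3)] DL(2) by simp
    then show ?thesis using DL(2,6) by blast
  qed
  ultimately show ?thesis
    using LK_phiL DL by simp
next
  case (DR us \<Gamma> \<Delta>)
  let ?G = "image_mset unfold \<Gamma>" and ?D = "image_mset unfold \<Delta>"
  let ?as = "map (tsubst (sim us)) ts"
  have us: "\<forall>u\<in>set us. wf_tm L u" using DR by simp
  have wf: "wf_seq L (?G \<Rrightarrow> ?D)" using wf_replace_seq[OF assms(3)] DR(2) by simp
  have "LK L X (?G \<Rrightarrow> add_mset B ?D)" if B: "B \<in> set (clauses ?as us)" for B
  proof -
    from B consider t where "t \<in> set ts" "B = Eq (tsubst (sim us) t) (tsubst (sim us) t)"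
      | A where "A \<in> set As" "B = fsubst (sim us) A"
      by (auto simp: clauses_def zip_map1 zip_same_conv_map)
    then show ?thesis
    proof cases
      case 1
      then have "wf_tm L (tsubst (sim us) t)"
        using wf_ts wf_tm_sim[OF us] by (auto intro: wf_tm_tsubst)
      then show ?thesis
        using 1 wf by (intro LK_structural[OF EqRefl[of L "tsubst (sim us) t"]]) auto
    next
      case 2
      then show ?thesis using assms(2) DR(1) replace_clauses[OF B] by auto
    qed
  qed
  then have "LK L X (?G \<Rrightarrow> add_mset (fsubst (sim ?as) \<phi>) ?D)"
    using DR us wf by (intro LK_phiR[of ?as us]) auto
  then show ?thesis using DR(2) by simp
qed

text \<open>
  Each rule is translated into itself, with the same eigenvariable, because replacement commutes with
  instantiation and adds no free variables; \<open>LK_replace_fcs_rule\<close> and \<open>LK_phi_congruence\<close> settle the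
  two exceptions.
\<close>

lemma LK_replace:
  assumes "LK LD (fcs_rule LD D n ts As) S"
  shows "LK L X (replace_seq S)"
  using assms
proof (induction rule: LK.induct)
  case (EqFun ss us f)
  then have "LK L X (mset (map2 Eq ss us) \<Rrightarrow> {#Eq (Fn f ss) (Fn f us)#})"
    by (intro LK.EqFun) (simp_all only: wf_tm_add_pred)
  then show ?case by (simp only: replace_seq.simps replace_map2_Eq) simp
next
  case (EqPred ss us p)
  have "LK L X (add_mset (unfold (Pred p ss)) (mset (map2 Eq ss us)) \<Rrightarrow> {#unfold (Pred p us)#})"
  proof (cases "p = D")
    case True
    then have "length ss = length ts" "length us = length ts"
      "\<forall>s\<in>set ss. wf_tm L s" "\<forall>u\<in>set us. wf_tm L u"
      using EqPred by (auto simp: preds_add_pred)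
    from LK_phi_congruence[OF this, of X] True show ?thesis
      by (simp only: replace.simps simp_thms if_True)
  next
    case False
    then have "LK L X (add_mset (Pred p ss) (mset (map2 Eq ss us)) \<Rrightarrow> {#Pred p us#})"
      using EqPred by (intro LK.EqPred) (auto simp: preds_add_pred)
    with False show ?thesis by (simp only: replace.simps if_False)
  qed
  then show ?case
    by (simp only: replace_seq.simps image_mset_add_mset replace_map2_Eq image_mset_empty)
next
  case (AllL t A \<Gamma> \<Delta>)
  then have "wf_fm LD A" by (auto dest!: LK_imp_wf_seq simp: wf_fm_inst)
  then show ?case using AllL LK.AllL[of L X t "unfold A"] by (simp add: replace_inst)
next
  case (AllR \<Gamma> y A \<Delta>)
  have wf: "wf_seq LD (\<Gamma> \<Rrightarrow> add_mset (All A) \<Delta>)"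
    using LK.AllR[OF AllR.hyps] by (rule LK_imp_wf_seq)
  then have "LK L X (image_mset unfold \<Gamma> \<Rrightarrow> add_mset (inst (Var y) (unfold A)) (image_mset unfold \<Delta>))"
    using AllR.IH by (simp add: replace_inst)
  moreover have "y \<notin> fv_seq (image_mset unfold \<Gamma> \<Rrightarrow> add_mset (All (unfold A)) (image_mset unfold \<Delta>))"
    using subsetD[OF fv_replace_seq[OF wf], of y] AllR.hyps(2)
    unfolding replace_seq.simps image_mset_add_mset replace.simps by blast
  ultimately show ?case
    unfolding replace_seq.simps image_mset_add_mset replace.simps by (rule LK.AllR)
next
  case (ExL y A \<Gamma> \<Delta>)
  have wf: "wf_seq LD (add_mset (Ex A) \<Gamma> \<Rrightarrow> \<Delta>)"
    using LK.ExL[OF ExL.hyps] by (rule LK_imp_wf_seq)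
  then have "LK L X (add_mset (inst (Var y) (unfold A)) (image_mset unfold \<Gamma>) \<Rrightarrow> image_mset unfold \<Delta>)"
    using ExL.IH by (simp add: replace_inst)
  moreover have "y \<notin> fv_seq (add_mset (Ex (unfold A)) (image_mset unfold \<Gamma>) \<Rrightarrow> image_mset unfold \<Delta>)"
    using subsetD[OF fv_replace_seq[OF wf], of y] ExL.hyps(2)
    unfolding replace_seq.simps image_mset_add_mset replace.simps by blast
  ultimately show ?case
    unfolding replace_seq.simps image_mset_add_mset replace.simps by (rule LK.ExL)
next
  case (ExR \<Gamma> t A \<Delta>)
  then have "wf_fm LD A" by (auto dest!: LK_imp_wf_seq simp: wf_fm_inst)
  then show ?case using ExR LK.ExR[of L X _ t "unfold A"] by (simp add: replace_inst)
next
  case (Extra Ps S)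
  then show ?case by (intro LK_replace_fcs_rule) auto
qed (simp_all only: replace_seq.simps image_mset_add_mset image_mset_union image_mset_empty
    replace.simps wf_fm.simps wf_tm_add_pred,
  (rule LK.intros; (assumption | (rule wf_fm_replace, assumption) | (simp; fail)))+)

section \<open>Equivalence of a formula and its unfolding\<close>

abbreviation fcs_entails where
  "fcs_entails \<equiv> entails LD (fcs_rule LD D n ts As)"

text \<open>
  From \<open>D(as)\<close> to \<open>\<phi>(as)\<close>, the eigenvariables of the left rule for \<open>D\<close> serve as witnesses for the
  quantifiers. Conversely, the right rule for \<open>D\<close> only reaches arguments of the form \<open>t\<^sub>i\<close> at some
  terms, called \<open>bs\<close> in the proof; the equality axiom for \<open>D\<close> leads from \<open>D(bs)\<close> to \<open>D(as)\<close>.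
\<close>

lemma fcs_entails_phi:
  assumes "length as = length ts" and as: "\<forall>a\<in>set as. wf_tm L a"
  shows "fcs_entails (Pred D as) (fsubst (sim as) \<phi>)"
    and "fcs_entails (fsubst (sim as) \<phi>) (Pred D as)"
proof -
  let ?X = "fcs_rule LD D n ts As"
  obtain \<zeta>s where \<zeta>s: "length \<zeta>s = n" "distinct \<zeta>s"
    "set \<zeta>s \<inter> fv_seq ({#Pred D as#} \<Rrightarrow> {#fsubst (sim as) \<phi>#}) = {}"
    using ex_fresh_list finite_fv_seq by blast
  let ?us = "map Var \<zeta>s :: 'f tm list"
  let ?bs = "map (tsubst (sim ?us)) ts"
  let ?\<Gamma> = "mset (clauses as ?us)"
  have wf\<Gamma>: "wf_fm LD B" if "B \<in># ?\<Gamma>" for B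
    using wf_fm_clauses[OF as, of ?us] that by (auto intro: wf_fm_LD)
  have wfD: "wf_fm LD (Pred D as)" "wf_fm LD (fsubst (sim as) \<phi>)"
    using assms wf_fm_LD[OF wf_phi_instance] by (auto simp: preds_add_pred)
  have wfb: "wf_tm L b" if "b \<in> set ?bs" for b
    using that wf_ts wf_tm_sim[of ?us L] by (auto intro: wf_tm_tsubst)
  have wfDb: "wf_fm LD (Pred D ?bs)"
    using wfb by (auto simp: preds_add_pred)

  have "LK LD ?X (?\<Gamma> \<Rrightarrow> {#fsubst (sim as) \<phi>#})"
    using assms(1) \<zeta>s(1) wf\<Gamma> by (intro LK_phiR[of as ?us]) (auto intro!: LK_member)
  then have *: "LK LD ?X (mset (map2 (\<lambda>a t. Eq a (tsubst (sim (map Var \<zeta>s)) t)) as ts)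
      + mset (map (fsubst (sim (map Var \<zeta>s))) As) + {#} \<Rrightarrow> {#fsubst (sim as) \<phi>#})"
    by (simp add: clauses_def)
  show "fcs_entails (Pred D as) (fsubst (sim as) \<phi>)"
    by (rule Extra, rule DL[OF assms(1) \<zeta>s]) (use * wfD in \<open>simp_all del: mset_map\<close>)

  have D_bs: "LK LD ?X (?\<Gamma> \<Rrightarrow> add_mset (Pred D ?bs) {#Pred D as#})"
  proof (rule Extra, rule DR)
    show "\<forall>P\<in>set (map (\<lambda>A. ?\<Gamma> \<Rrightarrow> add_mset (fsubst (sim ?us) A) {#Pred D as#}) As). LK LD ?X P"
    proof
      fix P assume "P \<in> set (map (\<lambda>A. ?\<Gamma> \<Rrightarrow> add_mset (fsubst (sim ?us) A) {#Pred D as#}) As)"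
      then obtain A where P: "P = (?\<Gamma> \<Rrightarrow> add_mset (fsubst (sim ?us) A) {#Pred D as#})"
        and "A \<in> set As" by auto
      then have "fsubst (sim ?us) A \<in># ?\<Gamma>" by (auto simp: clauses_def)
      then show "LK LD ?X P"
        using wf\<Gamma> wfD unfolding P by (intro LK_member[of "fsubst (sim ?us) A"]) auto
    qed
  qed (use \<zeta>s(1) wf\<Gamma> wfD wfDb in auto)
  have bs_as: "LK LD ?X (?\<Gamma> \<Rrightarrow> add_mset E {#Pred D as#})" if "E \<in># mset (map2 Eq ?bs as)" for E
  proof -
    from that obtain i where i: "i < length ts" "E = Eq (?bs ! i) (as ! i)"
      using assms(1) by (auto simp: in_set_zip)
    then have "Eq (as ! i) (?bs ! i) \<in># ?\<Gamma>"
      using assms(1) by (force simp: clauses_def in_set_zip)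
    moreover have "wf_tm L (as ! i)" "wf_tm L (?bs ! i)"
      using i(1) assms as wfb[of "?bs ! i"] by auto
    ultimately show ?thesis
      using i wf\<Gamma> wfD(1)
      by (intro LK_structural[OF LK_Eq_sym[of LD "as ! i" "?bs ! i"]]) auto
  qed
  have "LK LD ?X (add_mset (Pred D ?bs) (mset (map2 Eq ?bs as)) + ?\<Gamma> \<Rrightarrow> {#Pred D as#})"
  proof (rule LK_structural[OF EqPred[of ?bs as LD D]])
    show "wf_seq LD (add_mset (Pred D ?bs) (mset (map2 Eq ?bs as)) + ?\<Gamma> \<Rrightarrow> {#Pred D as#})"
      using wfDb wfD(1) wf\<Gamma> as wfb by (auto elim!: in_set_zipE)
  qed (use assms wfDb wfD in auto)
  then have "LK LD ?X (?\<Gamma> \<Rrightarrow> {#Pred D as#})"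
  proof (rule LK_multicut)
    fix E assume "E \<in># add_mset (Pred D ?bs) (mset (map2 Eq ?bs as))"
    then consider "E = Pred D ?bs" | "E \<in># mset (map2 Eq ?bs as)"
      unfolding set_mset_add_mset_insert by blast
    then show "LK LD ?X (?\<Gamma> \<Rrightarrow> add_mset E {#Pred D as#})"
      using D_bs bs_as by cases blast+
  qed
  then show "fcs_entails (fsubst (sim as) \<phi>) (Pred D as)"
    using assms(1) \<zeta>s by (intro LK_phiL[of LD ?X as \<zeta>s]) auto
qed

text \<open>
  The substitution is part of the induction statement because a quantified formula is reduced to the
  instances of its matrix, which are not subformulas.
\<close>

lemma fcs_entails_replace:
  assumes "wf_fm LD A" "\<And>i. wf_tm L (\<sigma> i)"
  shows "fcs_entails (fsubst \<sigma> A) (fsubst \<sigma> (unfold A)) \<and>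
    fcs_entails (fsubst \<sigma> (unfold A)) (fsubst \<sigma> A)"
  using assms
proof (induction A arbitrary: \<sigma>)
  case (Eq s t)
  then show ?case by (auto intro!: Ax wf_tm_tsubst)
next
  case (Pred p ss)
  show ?case
  proof (cases "p = D")
    case True
    let ?as = "map (tsubst \<sigma>) ss"
    have "length ss = length ts" "\<forall>a\<in>set ?as. wf_tm L a"
      using True Pred by (auto simp: preds_add_pred intro!: wf_tm_tsubst)
    then show ?thesis
      using True fcs_entails_phi[of ?as] fv_phi by (simp add: fsubst_fsubst_sim)
  next
    case False
    then show ?thesis using Pred by (auto intro!: Ax wf_tm_tsubst)
  qed
next
  case (All A)
  then have "fcs_entails (fsubst (case_nat (Var y) \<sigma>) A) (fsubst (case_nat (Var y) \<sigma>) (unfold A)) \<and>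
      fcs_entails (fsubst (case_nat (Var y) \<sigma>) (unfold A)) (fsubst (case_nat (Var y) \<sigma>) A)" for y
    by (intro All.IH) (auto split: nat.split)
  then show ?case by (auto simp: inst_fsubst_up intro!: entails_All)
next
  case (Ex A)
  then have "fcs_entails (fsubst (case_nat (Var y) \<sigma>) A) (fsubst (case_nat (Var y) \<sigma>) (unfold A)) \<and>
      fcs_entails (fsubst (case_nat (Var y) \<sigma>) (unfold A)) (fsubst (case_nat (Var y) \<sigma>) A)" for y
    by (intro Ex.IH) (auto split: nat.split)
  then show ?case by (auto simp: inst_fsubst_up intro!: entails_Ex)
qed (auto intro!: entails_Neg entails_And entails_Or entails_Imp)

lemma proves_iff:
  assumes "wf_fm LD \<psi>"
  shows "LKe_fcs L D n ts As \<turnstile> \<psi> \<longleftrightarrow> LKe L \<turnstile> unfold \<psi>"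
proof
  assume "LKe_fcs L D n ts As \<turnstile> \<psi>"
  then have "LK LD (fcs_rule LD D n ts As) ({#} \<Rrightarrow> {#\<psi>#})"
    by (simp add: proves_def LKe_fcs_def Let_def)
  from LK_replace[OF this] show "LKe L \<turnstile> unfold \<psi>"
    by (simp add: proves_def LKe_def)
next
  let ?X = "fcs_rule LD D n ts As"
  assume "LKe L \<turnstile> unfold \<psi>"
  then have "LK L (\<lambda>Ps S. False) ({#} \<Rrightarrow> {#unfold \<psi>#})"
    by (simp add: proves_def LKe_def)
  then have "LK LD ?X ({#} \<Rrightarrow> {#unfold \<psi>#})"
    by (rule LK_mono) (auto intro: wf_fm_LD)
  moreover have "fcs_entails (unfold \<psi>) \<psi>"
    using fcs_entails_replace[OF assms, of Var] by (simp add: fsubst_Var)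
  ultimately show "LKe_fcs L D n ts As \<turnstile> \<psi>"
    using Cut[of LD ?X "{#}" "unfold \<psi>" "{#}" "{#}" "{#\<psi>#}"]
    by (simp add: proves_def LKe_fcs_def Let_def)
qed

end

theorem theorem3p4:
  fixes L :: "('f, 'p) language" and D :: 'p and r n :: nat
    and ts :: "'f tm list" and As :: "('f, 'p) fm list" and \<psi> :: "('f, 'p) fm"
  assumes "D \<notin> dom (preds L)"
    and "length ts = r"
    and "\<forall>t\<in>set ts. wf_tm L t \<and> tfv t \<subseteq> {..<n}"
    and "\<forall>A\<in>set As. is_atom A \<and> wf_fm L A \<and> fv A \<subseteq> {..<n}"
    and "wf_fm (add_pred L D r) \<psi>"
  shows "LKe_fcs L D n ts As \<turnstile> \<psi> \<longleftrightarrow> LKe L \<turnstile> replace D (fcs_fm n ts As) \<psi>"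
proof -
  interpret conjunctive_definition L D n ts As
    using assms by unfold_locales auto
  show ?thesis using assms(2,5) proves_iff by simp
qed

end
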